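(* Let $d$ be a positive integer and let $A$ be a real $d \times d$ (symmetric) positive-definite matrix with spectral condition number $\kappa(A) = \lambda_{\max}(A)/\lambda_{\min}(A)$. Then there exist a positive integer $m$ satisfying $$m \leq 1 + \frac{1}{2}\sqrt{(d-1)\cdot \kappa(A)},$$ a positive integer $r \leq d(d+1)/2$, positive real numbers $\alpha_1, \dots, \alpha_r$, and integer vectors $z_1, \dots, z_r \in \mathbb{Z}^d_m$ such that $$A = \sum_{i=1}^r \alpha_i z_i z_i^*.$$
   Context: For positive integers $m$ and $d$, $\mathbb{Z}^d_m := \{ z \in \mathbb{Z}^d : |z_i| \leq m \text{ for } i = 1, \dots, d \}$ denotes the set of integer (column) vectors with entries bounded by $m$ in absolute value. The symbol ${}^*$ denotes the transpose. A real $d \times d$ matrix $A$ is positive definite if $A = A^*$ and $u^* A u > 0$ for every nonzero $u \in \mathbb{R}^d$. For such a matrix, $\lambda_{\max}(A)$ and $\lambda_{\min}(A)$ denote its largest and smallest eigenvalues. *)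

theory Defs
  imports "HOL-Analysis.Analysis"
begin

definition positive_definite :: "real^'n^'n \<Rightarrow> bool" where
  "positive_definite A \<longleftrightarrow> transpose A = A \<and> (\<forall>u. u \<noteq> 0 \<longrightarrow> u \<bullet> (A *v u) > 0)"

definition eigenvalues :: "real^'n^'n \<Rightarrow> real set" where
  "eigenvalues A = {c. \<exists>v. v \<noteq> 0 \<and> A *v v = c *\<^sub>R v}"

(* Max and Min are only meaningful on finite nonempty sets; the set of (real) eigenvalues of a
   symmetric real matrix is finite and nonempty by the spectral theorem. *)

definition lambda_max :: "real^'n^'n \<Rightarrow> real" where
  "lambda_max A = Max (eigenvalues A)"

definition lambda_min :: "real^'n^'n \<Rightarrow> real" where
  "lambda_min A = Min (eigenvalues A)"

definition cond_number :: "real^'n^'n \<Rightarrow> real" where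
  "cond_number A = lambda_max A / lambda_min A"

definition int_vecs :: "nat \<Rightarrow> (int^'n) set" where
  "int_vecs m = {z. \<forall>i. \<bar>z $ i\<bar> \<le> int m}"

(* An integer vector as a real d x 1 matrix, so that z z* is literally a matrix product. *)

definition real_column :: "int^'n \<Rightarrow> real^1^'n" where
  "real_column z = columnvector (\<chi> i. real_of_int (z $ i))"

end

theory Submission
  imports Defs
begin

text \<open>
  The idea is to round the spectral decomposition of \<open>A\<close> to integer vectors and to let the smallest
  eigenvalue pay for the rounding error.

  Let \<open>d\<close> be the dimension, let \<open>B\<close> be an orthonormal basis of eigenvectors, and write
  \<open>A = lo I + \<Sum> (\<mu> b - lo) b b*\<close>, where \<open>lo\<close> and \<open>hi\<close> are the extreme eigenvalues. The vector \<open>m b\<close>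
  has entries in \<open>[-m, m]\<close>. Rounding each entry \<open>t\<close> of it independently at random, up with
  probability \<open>frac t\<close> and down otherwise, gives a random integer vector \<open>z\<close> with entries bounded
  by \<open>m\<close>, with mean \<open>m b\<close>, and with a diagonal covariance matrix \<open>D b\<close> whose entries
  \<open>frac t (1 - frac t)\<close> are at most \<open>1/4\<close>. Hence \<open>m\<^sup>2 b b* + D b\<close> is the expectation of \<open>z z*\<close>, a convex
  combination of admissible integer squares (\<open>rounding_in_convex_hull\<close>). Substituting,
  \<open>A\<close> is a nonnegative combination of integer squares plus the diagonal matrix
  \<open>lo I - \<Sum> (\<mu> b - lo) / m\<^sup>2 D b\<close>. The coefficient of an eigenvector for \<open>lo\<close> vanishes, so at most
  \<open>d - 1\<close> terms remain and each entry of the sum is at most \<open>(d - 1) hi / (4 m\<^sup>2)\<close>. This is at most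
  \<open>lo\<close> once \<open>4 m\<^sup>2\<close> reaches \<open>(d - 1)\<close> times the condition number, and a nonnegative diagonal matrix is
  a nonnegative combination of the integer squares of the standard basis vectors
  (\<open>mem_cone_int_squares\<close>). The least positive integer \<open>m\<close> satisfying this inequality obeys the
  claimed bound.

  The number of terms is then reduced to the dimension \<open>d (d + 1) / 2\<close> of the space of symmetric
  matrices by Caratheodory's theorem for cones (\<open>conic_caratheodory\<close>). The remaining ingredient is the
  spectral theorem for real symmetric matrices (\<open>self_adjoint_orthonormal_eigenbasis\<close>,
  \<open>symmetric_spectral_decomposition\<close>).
\<close>

section \<open>The spectral theorem\<close>

text \<open>
  The quadratic form \<open>q y = \<mu> (y \<bullet> y) - y \<bullet> f y\<close> is nonnegative on \<open>S\<close> and vanishes at \<open>x\<close>, so its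
  derivative at \<open>x\<close> vanishes in every direction of \<open>S\<close>. That derivative is the inner product with
  \<open>2 w\<close>, where \<open>w = \<mu> x - f x\<close> is itself a direction in \<open>S\<close>.
\<close>
lemma self_adjoint_maximizer_eigenvector:
  fixes f :: "'a::real_inner \<Rightarrow> 'a"
  assumes "linear f" and adj: "\<And>x y. f x \<bullet> y = x \<bullet> f y"
    and "subspace S" and inv: "f ` S \<subseteq> S"
    and x: "x \<in> S" "x \<bullet> f x = \<mu> * (x \<bullet> x)"
    and max: "\<And>y. y \<in> S \<Longrightarrow> y \<bullet> f y \<le> \<mu> * (y \<bullet> y)"
  shows "f x = \<mu> *\<^sub>R x"
proof -
  interpret linear f by fact
  define w where "w = \<mu> *\<^sub>R x - f x"
  have wS: "w \<in> S"
    unfolding w_def using assms by (auto intro!: subspace_diff subspace_scale)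
  define q where "q y = \<mu> * (y \<bullet> y) - y \<bullet> f y" for y
  have q_nonneg: "0 \<le> q y" if "y \<in> S" for y
    using max[OF that] by (simp add: q_def)
  have expand: "q (x - t *\<^sub>R w) = t * (t * q w - 2 * (w \<bullet> w))" for t
  proof -
    have "q (x - t *\<^sub>R w) = q x - t * (2 * (w \<bullet> (\<mu> *\<^sub>R x)) - w \<bullet> f x - x \<bullet> f w) + t\<^sup>2 * q w"
      by (simp add: q_def diff scale inner_diff_left inner_diff_right inner_commute
          algebra_simps power2_eq_square)
    moreover have "x \<bullet> f w = w \<bullet> f x"
      using adj[of x w] by (simp add: inner_commute)
    moreover have "q x = 0"
      using x(2) by (simp add: q_def)
    moreover have "w \<bullet> w = w \<bullet> (\<mu> *\<^sub>R x) - w \<bullet> f x"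
      by (subst (2) w_def) (simp add: inner_diff_right)
    ultimately have "q (x - t *\<^sub>R w) = 0 - t * (2 * (w \<bullet> w)) + t\<^sup>2 * q w"
      by simp
    then show ?thesis
      by (simp add: algebra_simps power2_eq_square)
  qed
  have "w \<bullet> w \<le> 0"
  proof (rule ccontr)
    assume "\<not> w \<bullet> w \<le> 0"
    then have pos: "w \<bullet> w > 0" by linarith
    \<comment> \<open>A step small enough for the linear term to dominate; the \<open>1\<close> only avoids division by zero.\<close>
    define t where "t = (w \<bullet> w) / (q w + 1)"
    have qw: "q w + 1 > 0" using q_nonneg[OF wS] by simp
    then have "t > 0" using pos by (simp add: t_def)
    moreover have "t * q w \<le> w \<bullet> w"
      using qw pos by (simp add: t_def field_simps)
    ultimately have "t * (t * q w - 2 * (w \<bullet> w)) < 0"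
      using pos by (intro mult_pos_neg) linarith+
    moreover have "0 \<le> q (x - t *\<^sub>R w)"
      using x(1) wS assms(3) by (intro q_nonneg subspace_diff subspace_scale)
    ultimately show False using expand[of t] by simp
  qed
  then have "w = 0" by (meson inner_gt_zero_iff not_le)
  then show ?thesis by (simp add: w_def)
qed

text \<open>
  A maximizer of the quadratic form on the unit sphere of \<open>S\<close> is an eigenvector, and since \<open>f\<close> is
  self-adjoint, the orthogonal complement of that vector in \<open>S\<close> is again invariant. The subspace \<open>S\<close>
  is there for this induction on the dimension.
\<close>
theorem self_adjoint_orthonormal_eigenbasis:
  fixes f :: "'a::euclidean_space \<Rightarrow> 'a"
  assumes f: "linear f" "\<And>x y. f x \<bullet> y = x \<bullet> f y"
    and S: "subspace S" "f ` S \<subseteq> S"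
  obtains B where "B \<subseteq> S" "span B = S" "pairwise orthogonal B"
    "\<And>b. b \<in> B \<Longrightarrow> norm b = 1" "\<And>b. b \<in> B \<Longrightarrow> f b = (b \<bullet> f b) *\<^sub>R b"
proof -
  have "\<exists>B\<subseteq>S. span B = S \<and> pairwise orthogonal B \<and>
          (\<forall>b\<in>B. norm b = 1 \<and> f b = (b \<bullet> f b) *\<^sub>R b)"
    using S
  proof (induction "dim S" arbitrary: S rule: less_induct)
    case less
    show ?case
    proof (cases "S = {0}")
      case True
      then show ?thesis by (intro exI[of _ "{}"]) (auto simp: pairwise_def)
    next
      case False
      then obtain y where y: "y \<in> S" "y \<noteq> 0"
        using subspace_0[OF less.prems(1)] by blast
      have cont: "continuous_on X (\<lambda>x. x \<bullet> f x)" for X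
        using f(1) by (intro continuous_intros linear_continuous_on) (simp add: linear_linear)
      have "compact (S \<inter> sphere 0 1)"
        using closed_subspace[OF less.prems(1)] by (intro closed_Int_compact) auto
      moreover have "y /\<^sub>R norm y \<in> S \<inter> sphere 0 1"
        using y less.prems(1) by (auto intro: subspace_scale)
      ultimately obtain x where x: "x \<in> S" "norm x = 1"
        and xmax: "\<And>z. z \<in> S \<inter> sphere 0 1 \<Longrightarrow> z \<bullet> f z \<le> x \<bullet> f x"
        using continuous_attains_sup[OF _ _ cont, of "S \<inter> sphere 0 1"] by fastforce
      have xx: "x \<bullet> x = 1" using x(2) by (simp add: dot_square_norm)
      have max: "z \<bullet> f z \<le> (x \<bullet> f x) * (z \<bullet> z)" if "z \<in> S" for z
      proof (cases "z = 0")
        case True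
        then show ?thesis using linear_0[OF f(1)] by simp
      next
        case False
        have "(z /\<^sub>R norm z) \<bullet> f (z /\<^sub>R norm z) \<le> x \<bullet> f x"
          using False that less.prems(1) by (intro xmax) (auto intro: subspace_scale)
        moreover have "(z /\<^sub>R norm z) \<bullet> f (z /\<^sub>R norm z) = (z \<bullet> f z) / (norm z)\<^sup>2"
          by (subst linear_cmul[OF f(1)]) (simp add: power2_eq_square divide_inverse)
        ultimately have "(z \<bullet> f z) / (norm z)\<^sup>2 \<le> x \<bullet> f x" by simp
        then show ?thesis
          using False by (simp add: pos_divide_le_eq dot_square_norm)
      qed
      have fx: "f x = (x \<bullet> f x) *\<^sub>R x"
        using xx by (intro self_adjoint_maximizer_eigenvector[OF f less.prems x(1) _ max]) auto
      define T where "T = S \<inter> {z. x \<bullet> z = 0}"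
      have T: "subspace T"
        unfolding T_def by (intro subspace_inter less.prems subspace_hyperplane)
      have "f ` T \<subseteq> T"
      proof safe
        fix z assume "z \<in> T"
        then have z: "z \<in> S" "x \<bullet> z = 0" by (auto simp: T_def)
        have "x \<bullet> f z = (x \<bullet> f x) * (x \<bullet> z)"
          using f(2)[of x z] fx by (metis inner_scaleR_left)
        then show "f z \<in> T" using z less.prems(2) by (auto simp: T_def)
      qed
      moreover have "dim T < dim S"
      proof -
        have "x \<notin> T" using xx by (simp add: T_def)
        then have "T \<subset> S" using x(1) by (metis T_def inf_le1 psubsetI)
        then show ?thesis
          using T less.prems(1) by (metis dim_psubset span_eq_iff)
      qed
      ultimately obtain B where B: "B \<subseteq> T" "span B = T" "pairwise orthogonal B"
          "\<And>b. b \<in> B \<Longrightarrow> norm b = 1 \<and> f b = (b \<bullet> f b) *\<^sub>R b"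
        using less.hyps[of T] T by metis
      have "span (insert x B) = S"
      proof
        show "span (insert x B) \<subseteq> S"
          using B(1) x(1) less.prems(1) by (intro span_minimal) (auto simp: T_def)
        show "S \<subseteq> span (insert x B)"
        proof
          fix z assume "z \<in> S"
          then have "z - (x \<bullet> z) *\<^sub>R x \<in> T"
            using x(1) xx less.prems(1)
            by (auto simp: T_def inner_diff_right intro!: subspace_diff subspace_scale)
          then show "z \<in> span (insert x B)"
            using B(2) by (auto simp: span_insert)
        qed
      qed
      moreover have "pairwise orthogonal (insert x B)"
        using B(1,3) by (auto simp: pairwise_insert T_def orthogonal_def inner_commute)
      ultimately show ?thesis
        using B x fx by (intro exI[of _ "insert x B"]) (auto simp: T_def)
    qed
  qed
  then show ?thesis using that by blast
qed

section \<open>Caratheodory's theorem for cones\<close>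

text \<open>
  A positive combination with the fewest terms uses independent vectors: along a linear relation
  between them the coefficients could be shifted until the first one reaches zero.
\<close>
theorem conic_caratheodory:
  fixes S :: "'a::euclidean_space set"
  assumes "x \<in> convex_cone hull S"
  obtains T w where "T \<subseteq> S" "independent T" "\<And>s. s \<in> T \<Longrightarrow> 0 < w s" "x = (\<Sum>s\<in>T. w s *\<^sub>R s)"
proof -
  define comb where "comb x T w \<longleftrightarrow> finite T \<and> T \<subseteq> S \<and> (\<forall>s\<in>T. 0 < w s) \<and> x = (\<Sum>s\<in>T. w s *\<^sub>R s)"
    for x T and w :: "'a \<Rightarrow> real"
  have nonneg: "\<exists>T' w'. comb y T' w' \<and> T' \<subseteq> T"
    if "finite T" "T \<subseteq> S" "\<And>s. s \<in> T \<Longrightarrow> 0 \<le> w s" "y = (\<Sum>s\<in>T. w s *\<^sub>R s)" for y T w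
  proof -
    have "y = (\<Sum>s\<in>{s \<in> T. 0 < w s}. w s *\<^sub>R s)"
      unfolding that(4) using that(1,3) by (intro sum.mono_neutral_right) force+
    then show ?thesis
      using that(1,2) by (intro exI[of _ "{s \<in> T. 0 < w s}"] exI[of _ w]) (auto simp: comb_def)
  qed
  have "convex_cone {x. \<exists>T w. comb x T w}"
    unfolding convex_cone_iff
  proof (intro conjI ballI allI impI; clarify?)
    show "\<exists>T w. comb 0 T w"
      by (auto simp: comb_def intro!: exI[of _ "{}"])
  next
    fix x y T U v w assume "comb x T v" "comb y U w"
    then have *: "finite T" "T \<subseteq> S" "\<forall>s\<in>T. 0 < v s" "x = (\<Sum>s\<in>T. v s *\<^sub>R s)"
      "finite U" "U \<subseteq> S" "\<forall>s\<in>U. 0 < w s" "y = (\<Sum>s\<in>U. w s *\<^sub>R s)"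
      by (auto simp: comb_def)
    define c where "c s = (if s \<in> T then v s else 0) + (if s \<in> U then w s else 0)" for s
    have "x = (\<Sum>s\<in>T \<union> U. (if s \<in> T then v s else 0) *\<^sub>R s)"
      using * by (auto intro!: sum.mono_neutral_cong_left)
    moreover have "y = (\<Sum>s\<in>T \<union> U. (if s \<in> U then w s else 0) *\<^sub>R s)"
      using * by (auto intro!: sum.mono_neutral_cong_left)
    ultimately have "x + y = (\<Sum>s\<in>T \<union> U. c s *\<^sub>R s)"
      by (simp add: c_def scaleR_add_left sum.distrib)
    then have "\<exists>T' w'. comb (x + y) T' w' \<and> T' \<subseteq> T \<union> U"
      using * by (intro nonneg[where w = c]) (auto simp: c_def less_imp_le add_nonneg_nonneg)
    then show "\<exists>T w. comb (x + y) T w" by blast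
  next
    fix x T w and c :: real assume "comb x T w" "0 \<le> c"
    then have "\<exists>T' w'. comb (c *\<^sub>R x) T' w' \<and> T' \<subseteq> T"
      by (intro nonneg[where w = "\<lambda>s. c * w s"])
        (auto simp: comb_def scaleR_sum_right less_imp_le)
    then show "\<exists>T w. comb (c *\<^sub>R x) T w" by blast
  qed
  moreover have "S \<subseteq> {x. \<exists>T w. comb x T w}"
  proof
    fix s assume "s \<in> S"
    then have "comb s {s} (\<lambda>_. 1)" by (auto simp: comb_def)
    then show "s \<in> {x. \<exists>T w. comb x T w}" by blast
  qed
  ultimately have "convex_cone hull S \<subseteq> {x. \<exists>T w. comb x T w}"
    by (rule hull_minimal[rotated])
  then have ex: "\<exists>k T w. comb x T w \<and> card T = k" using assms by blast
  define k where "k = (LEAST k. \<exists>T w. comb x T w \<and> card T = k)"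
  obtain T w where Tw: "comb x T w" "card T = k"
    using LeastI_ex[OF ex] unfolding k_def by blast
  have least: "k \<le> card T'" if "comb x T' w'" for T' w'
    unfolding k_def using that by (intro Least_le) blast
  have T: "finite T" "T \<subseteq> S" "\<And>s. s \<in> T \<Longrightarrow> 0 < w s" "x = (\<Sum>s\<in>T. w s *\<^sub>R s)"
    using Tw(1) by (auto simp: comb_def)
  have "independent T"
  proof
    assume "dependent T"
    then obtain u a where "a \<in> T" "u a \<noteq> 0" "(\<Sum>v\<in>T. u v *\<^sub>R v) = 0"
      using T(1) by (auto simp: dependent_finite)
    \<comment> \<open>Changing the sign of the relation if necessary, it has a positive coefficient.\<close>
    then obtain u a where u: "a \<in> T" "0 < u a" "(\<Sum>v\<in>T. u v *\<^sub>R v) = 0"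
    proof (cases "0 < u a")
      case False
      then show ?thesis
        using \<open>a \<in> T\<close> \<open>u a \<noteq> 0\<close> \<open>(\<Sum>v\<in>T. u v *\<^sub>R v) = 0\<close>
        by (intro that[of a "\<lambda>v. - u v"]) (auto simp: sum_negf)
    qed (use that in blast)
    \<comment> \<open>The largest shift along the relation that keeps all coefficients nonnegative.\<close>
    define P where "P = {s \<in> T. 0 < u s}"
    define t where "t = Min ((\<lambda>s. w s / u s) ` P)"
    have P: "finite P" "P \<noteq> {}" using T(1) u by (auto simp: P_def)
    then obtain b where b: "b \<in> P" "t = w b / u b"
      unfolding t_def using Min_in[of "(\<lambda>s. w s / u s) ` P"] by blast
    have t_le: "t \<le> w s / u s" if "s \<in> P" for s
      unfolding t_def using P that by simp
    have "0 \<le> t" using b T(3) by (auto simp: P_def less_imp_le)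
    define c where "c s = w s - t * u s" for s
    have c: "0 \<le> c s" if "s \<in> T" for s
    proof (cases "0 < u s")
      case True
      then show ?thesis using t_le[of s] that by (simp add: c_def P_def field_simps)
    next
      case False
      then have "t * u s \<le> 0" using \<open>0 \<le> t\<close> by (intro mult_nonneg_nonpos) auto
      then show ?thesis using T(3)[OF that] by (simp add: c_def)
    qed
    have bT: "b \<in> T" "c b = 0" using b by (auto simp: c_def P_def)
    have "x = (\<Sum>s\<in>T. c s *\<^sub>R s)"
      using u(3) T(4) by (simp add: c_def scaleR_diff_left sum_subtractf flip: scaleR_scaleR scaleR_sum_right)
    then have "x = (\<Sum>s\<in>T - {b}. c s *\<^sub>R s)"
      using bT T(1) by (simp add: sum.remove[of T b])
    then have "\<exists>T' w'. comb x T' w' \<and> T' \<subseteq> T - {b}"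
      using T c by (intro nonneg[where w = c]) auto
    then obtain T' w' where "comb x T' w'" "T' \<subseteq> T - {b}" by blast
    then have "card T' \<le> card (T - {b})" using T(1) by (intro card_mono) auto
    also have "\<dots> < card T" using bT(1) T(1) by (meson card_Diff1_less)
    finally show False using least[OF \<open>comb x T' w'\<close>] Tw(2) by simp
  qed
  then show ?thesis using that T by blast
qed

text \<open>
  An entry of a symmetric matrix depends only on the unordered pair of its indices, that is, on an
  index set with one or two elements. The matrices \<open>E p\<close> indexed by these sets span; using sets
  avoids choosing an order on the index type.
\<close>
lemma dim_symmetric_matrices_le:
  "dim {M :: real^'n^'n. transpose M = M} \<le> CARD('n) * (CARD('n) + 1) div 2"
proof -
  define E :: "'n set \<Rightarrow> real^'n^'n" where "E p = (\<chi> i j. if {i, j} = p then 1 else 0)" for p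
  define Q where "Q = {p :: 'n set. card p = 1} \<union> {p. card p = 2}"
  have "{M :: real^'n^'n. transpose M = M} \<subseteq> span (E ` Q)"
  proof safe
    fix M :: "real^'n^'n" assume M: "transpose M = M"
    have sym: "M $ i $ j = M $ j $ i" for i j
      using M by (metis transpose_def vec_lambda_beta)
    define c where "c p = (SOME a. \<exists>i j. p = {i, j} \<and> a = M $ i $ j)" for p
    have c: "c {i, j} = M $ i $ j" for i j
      unfolding c_def using sym by (intro some_equality) (auto simp: doubleton_eq_iff)
    have "M = (\<Sum>p\<in>Q. c p *\<^sub>R E p)"
    proof (simp add: vec_eq_iff, intro allI)
      fix i j
      have "{i, j} \<in> Q" by (auto simp: Q_def card_insert_if)
      then have "(\<Sum>p\<in>Q. c p * E p $ i $ j) = (\<Sum>p\<in>{{i, j}}. c p * E p $ i $ j)"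
        by (intro sum.mono_neutral_right) (auto simp: E_def)
      then show "M $ i $ j = (\<Sum>p\<in>Q. c p * E p $ i $ j)"
        by (simp add: E_def c)
    qed
    then show "M \<in> span (E ` Q)"
      by (metis (no_types, lifting) imageI span_base span_scale span_sum)
  qed
  then have "dim {M :: real^'n^'n. transpose M = M} \<le> card (E ` Q)"
    by (intro dim_le_card) auto
  also have "\<dots> \<le> card Q" by (intro card_image_le) auto
  also have "\<dots> \<le> card {p :: 'n set. card p = 1} + card {p :: 'n set. card p = 2}"
    unfolding Q_def by (rule card_Un_le)
  also have "\<dots> = CARD('n) + (CARD('n) choose 2)"
    using n_subsets[of "UNIV :: 'n set" 1] n_subsets[of "UNIV :: 'n set" 2] by simp
  also have "\<dots> = CARD('n) * (CARD('n) + 1) div 2"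
    by (cases "CARD('n)") (auto simp: choose_two algebra_simps)
  finally show ?thesis .
qed

section \<open>Squares of integer vectors\<close>

definition outer_square :: "real^'n \<Rightarrow> real^'n^'n" where
  "outer_square v = (\<chi> i j. v $ i * v $ j)"

definition diag_matrix :: "real^'n \<Rightarrow> real^'n^'n" where
  "diag_matrix c = (\<chi> i j. if i = j then c $ i else 0)"

definition int_squares :: "nat \<Rightarrow> (real^'n^'n) set" where
  "int_squares m = (\<lambda>z. real_column z ** transpose (real_column z)) ` int_vecs m"

lemma real_column_mult_transpose:
  "real_column z ** transpose (real_column z) = outer_square (\<chi> i. real_of_int (z $ i))"
  by (simp add: vec_eq_iff matrix_matrix_mult_def transpose_def real_column_def columnvector_def
      outer_square_def)

lemma transpose_outer_square: "transpose (outer_square v) = outer_square v"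
  by (simp add: vec_eq_iff transpose_def outer_square_def mult.commute)

lemma outer_square_vector_mult: "outer_square v *v x = (v \<bullet> x) *\<^sub>R v"
  by (simp add: vec_eq_iff matrix_vector_mult_def outer_square_def inner_vec_def
      sum_distrib_left sum_distrib_right mult_ac)

lemma outer_square_scaleR: "outer_square (c *\<^sub>R v) = c\<^sup>2 *\<^sub>R outer_square v"
  by (simp add: vec_eq_iff outer_square_def power2_eq_square mult_ac)

lemma linear_diag_matrix: "linear diag_matrix"
  by (rule linearI) (auto simp: vec_eq_iff diag_matrix_def)

lemma outer_square_in_int_squares:
  fixes v :: "real^'n"
  assumes "\<And>i. v $ i \<in> \<int>" "\<And>i. \<bar>v $ i\<bar> \<le> real m"
  shows "outer_square v \<in> int_squares m"
proof -
  define z :: "int^'n" where "z = (\<chi> i. \<lfloor>v $ i\<rfloor>)"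
  have z: "real_of_int (z $ i) = v $ i" for i
    using assms(1)[of i] by (simp add: z_def)
  have "z \<in> int_vecs m"
    unfolding int_vecs_def
  proof (intro CollectI allI)
    fix i
    have "real_of_int \<bar>z $ i\<bar> \<le> real_of_int (int m)"
      using assms(2)[of i] by (simp add: z)
    then show "\<bar>z $ i\<bar> \<le> int m" by linarith
  qed
  moreover have "outer_square v = real_column z ** transpose (real_column z)"
    by (simp add: real_column_mult_transpose z)
  ultimately show ?thesis
    unfolding int_squares_def by blast
qed

lemma convex_cone_sum_mem:
  assumes "convex_cone K" "\<And>i. i \<in> I \<Longrightarrow> f i \<in> K"
  shows "sum f I \<in> K"
  using assms(2)
  by (induction I rule: infinite_finite_induct)
    (auto intro: convex_cone_add convex_cone_contains_0 assms(1))

text \<open>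
  A diagonal matrix is a combination of the squares of the standard basis vectors, which are integer
  vectors with entries bounded by \<open>1\<close>.
\<close>
lemma diag_matrix_in_cone:
  fixes c :: "real^'n"
  assumes "1 \<le> m" "\<And>i. 0 \<le> c $ i"
  shows "diag_matrix c \<in> convex_cone hull (int_squares m)"
proof -
  have "diag_matrix c = (\<Sum>k\<in>UNIV. c $ k *\<^sub>R outer_square (axis k 1))"
  proof -
    have "(\<Sum>k\<in>UNIV. c $ k * (axis k 1 $ i * axis k 1 $ j)) =
        (\<Sum>k\<in>UNIV. if k = i then if i = j then c $ i else 0 else 0)" for i j
      by (intro sum.cong) (auto simp: axis_def)
    then show ?thesis by (simp add: vec_eq_iff diag_matrix_def outer_square_def)
  qed
  moreover have "outer_square (axis k 1) \<in> int_squares m" for k :: 'n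
    using assms(1) by (intro outer_square_in_int_squares) (auto simp: axis_def)
  then have "c $ k *\<^sub>R outer_square (axis k 1) \<in> convex_cone hull (int_squares m)" for k
    using assms(2) by (intro convex_cone_hull_mul) (auto intro: hull_inc)
  ultimately show ?thesis
    by (simp add: convex_cone_sum_mem[OF convex_cone_convex_cone_hull])
qed

section \<open>Randomized rounding\<close>

text \<open>
  The variance of the integer that is \<open>\<lfloor>t\<rfloor> + 1\<close> with probability \<open>frac t\<close> and \<open>\<lfloor>t\<rfloor>\<close> otherwise.
\<close>
abbreviation rounding_variance :: "real \<Rightarrow> real" where
  "rounding_variance t \<equiv> frac t * (1 - frac t)"

lemma rounding_variance_le: "rounding_variance t \<le> 1 / 4"
  using zero_le_power2[of "2 * frac t - 1"] by (simp add: power2_eq_square algebra_simps)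

text \<open>
  The matrix below is the expectation of \<open>z z*\<close> when the entries of \<open>u\<close> are rounded independently to
  a neighbouring integer with mean preserved: independence makes the off-diagonal entries
  multiplicative, and each diagonal entry gains the variance. Instead of a product distribution,
  the induction rounds one entry at a time, which expresses the matrix for \<open>u\<close> as a convex
  combination of the matrices for two vectors with one fractional entry less.
\<close>
lemma rounding_in_convex_hull:
  fixes u :: "real^'n"
  assumes "\<And>i. \<bar>u $ i\<bar> \<le> real m"
  shows "outer_square u + diag_matrix (\<chi> i. rounding_variance (u $ i)) \<in> convex hull (int_squares m)"
  using assms
proof (induction "card {i. u $ i \<notin> \<int>}" arbitrary: u rule: less_induct)
  case less
  define P where "P v = outer_square v + diag_matrix (\<chi> i. rounding_variance (v $ i))" for v :: "real^'n"
  show ?case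
  proof (cases "\<forall>i. u $ i \<in> \<int>")
    case True
    then have "P u = outer_square u"
      by (simp add: P_def vec_eq_iff diag_matrix_def)
    then show ?thesis
      using True less.prems outer_square_in_int_squares[of u m] unfolding P_def
      by (simp add: hull_inc)
  next
    case False
    then obtain i where i: "u $ i \<notin> \<int>" by blast
    define n where "n = \<lfloor>u $ i\<rfloor>"
    define p where "p = frac (u $ i)"
    define upd where "upd t = (\<chi> j. if j = i then t else u $ j)" for t
    have ui: "u $ i = n + p" by (simp add: n_def p_def frac_def)
    have p: "0 < p" "p < 1" using i by (auto simp: p_def frac_lt_1)
    then have frac_p: "frac p = p" by (simp add: frac_eq)
    have IH: "P (upd (real_of_int k)) \<in> convex hull (int_squares m)" if "k = n \<or> k = n + 1" for k
      unfolding P_def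
    proof (rule less.hyps)
      show "card {j. upd (real_of_int k) $ j \<notin> \<int>} < card {j. u $ j \<notin> \<int>}"
        using i by (intro psubset_card_mono) (auto simp: upd_def)
      have "- real m \<le> u $ i" "u $ i \<le> real m"
        using less.prems[of i] by auto
      \<comment> \<open>Rounding up stays within the bound, because a fractional entry is strictly below \<open>m\<close>.\<close>
      with ui p have "- int m \<le> n" "n + 1 \<le> int m"
        by linarith+
      with that have "\<bar>real_of_int k\<bar> \<le> real m" by linarith
      then show "\<bar>upd (real_of_int k) $ j\<bar> \<le> real m" for j
        using less.prems[of j] by (simp add: upd_def)
    qed
    have "P u = (1 - p) *\<^sub>R P (upd (real_of_int n)) + p *\<^sub>R P (upd (real_of_int (n + 1)))"
    proof -
      have "P u $ j $ k = (1 - p) * P (upd (real_of_int n)) $ j $ k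
              + p * P (upd (real_of_int (n + 1))) $ j $ k" for j k
        using ui by (cases "j = i"; cases "k = i")
          (auto simp: P_def outer_square_def diag_matrix_def upd_def frac_p algebra_simps)
      then show ?thesis by (simp add: vec_eq_iff)
    qed
    also have "\<dots> \<in> convex hull (int_squares m)"
      using p by (intro convexD[OF convex_convex_hull] IH) auto
    finally show ?thesis by (simp add: P_def)
  qed
qed

section \<open>Spectral decomposition of symmetric matrices\<close>

lemma positive_definite_imp_transpose: "positive_definite A \<Longrightarrow> transpose A = A"
  by (simp add: positive_definite_def)

lemma symmetric_matrix_inner:
  assumes "transpose A = (A :: real^'n^'n)"
  shows "(A *v x) \<bullet> y = x \<bullet> (A *v y)"
  by (metis assms dot_lmul_matrix transpose_matrix_vector)

text \<open>
  The basis is indexed by itself, with \<open>\<mu> b\<close> the eigenvalue of \<open>b\<close>, so that eigenvalues are listed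
  with multiplicity. That every eigenvalue is some \<open>\<mu> b\<close> holds because an eigenvector has a nonzero
  coefficient in the basis; it makes the extreme eigenvalues those of basis vectors.
\<close>
lemma symmetric_spectral_decomposition:
  fixes A :: "real^'n^'n"
  assumes "transpose A = A"
  obtains B :: "(real^'n) set" and \<mu> where
    "finite B" "card B = CARD('n)" "\<And>b. b \<in> B \<Longrightarrow> norm b = 1"
    "mat 1 = (\<Sum>b\<in>B. outer_square b)" "A = (\<Sum>b\<in>B. \<mu> b *\<^sub>R outer_square b)"
    "eigenvalues A = \<mu> ` B"
proof -
  note adj = symmetric_matrix_inner[OF assms]
  obtain B where B: "span B = UNIV" "pairwise orthogonal B"
      "\<And>b. b \<in> B \<Longrightarrow> norm b = 1" "\<And>b. b \<in> B \<Longrightarrow> A *v b = (b \<bullet> (A *v b)) *\<^sub>R b"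
    by (rule self_adjoint_orthonormal_eigenbasis[of "(*v) A" UNIV])
      (auto simp: adj matrix_vector_mul_linear)
  define \<mu> where "\<mu> b = b \<bullet> (A *v b)" for b
  have Ab: "A *v b = \<mu> b *\<^sub>R b" if "b \<in> B" for b
    using B(4)[OF that] by (simp add: \<mu>_def)
  have "0 \<notin> B" using B(3) by force
  with B(2) have ind: "independent B"
    by (rule pairwise_orthogonal_independent)
  then have fin: "finite B" by (rule independent_imp_finite)
  have card: "card B = CARD('n)"
    using dim_span_eq_card_independent[OF ind] B(1) by simp
  have expand: "x = (\<Sum>b\<in>B. (b \<bullet> x) *\<^sub>R b)" for x
    using orthonormal_basis_expand[OF B(2,3) _ fin, of x] B(1) by (simp add: inner_commute)
  have sum_mult: "(\<Sum>b\<in>B. M b) *v x = (\<Sum>b\<in>B. M b *v x)" for M :: "real^'n \<Rightarrow> real^'n^'n" and x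
    using fin by (induction B rule: finite_induct) (auto simp: matrix_vector_mult_add_rdistrib)
  have one: "mat 1 = (\<Sum>b\<in>B. outer_square b)"
    by (simp add: matrix_eq sum_mult outer_square_vector_mult flip: expand)
  have A: "A = (\<Sum>b\<in>B. \<mu> b *\<^sub>R outer_square b)"
    unfolding matrix_eq
  proof
    fix x
    have "A *v x = (\<Sum>b\<in>B. (b \<bullet> (A *v x)) *\<^sub>R b)" by (rule expand)
    also have "\<dots> = (\<Sum>b\<in>B. (\<mu> b * (b \<bullet> x)) *\<^sub>R b)"
      by (intro sum.cong refl) (simp add: Ab adj[symmetric, of _ x])
    also have "\<dots> = (\<Sum>b\<in>B. \<mu> b *\<^sub>R outer_square b) *v x"
      by (simp add: sum_mult outer_square_vector_mult flip: scaleR_matrix_vector_assoc)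
    finally show "A *v x = (\<Sum>b\<in>B. \<mu> b *\<^sub>R outer_square b) *v x" .
  qed
  have "eigenvalues A = \<mu> ` B"
  proof
    show "\<mu> ` B \<subseteq> eigenvalues A"
    proof safe
      fix b assume "b \<in> B"
      then have "b \<noteq> 0 \<and> A *v b = \<mu> b *\<^sub>R b" using Ab \<open>0 \<notin> B\<close> by metis
      then show "\<mu> b \<in> eigenvalues A"
        unfolding eigenvalues_def by (intro CollectI exI)
    qed
    show "eigenvalues A \<subseteq> \<mu> ` B"
    proof
      fix c assume "c \<in> eigenvalues A"
      then obtain v where v: "v \<noteq> 0" "A *v v = c *\<^sub>R v" by (auto simp: eigenvalues_def)
      have "\<exists>b\<in>B. b \<bullet> v \<noteq> 0"
      proof (rule ccontr)
        assume "\<not> (\<exists>b\<in>B. b \<bullet> v \<noteq> 0)"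
        then have "(\<Sum>b\<in>B. (b \<bullet> v) *\<^sub>R b) = 0" by (intro sum.neutral) simp
        then have "v = 0" by (simp only: flip: expand)
        then show False using v(1) by contradiction
      qed
      then obtain b where b: "b \<in> B" "b \<bullet> v \<noteq> 0" by blast
      have "\<mu> b * (b \<bullet> v) = c * (b \<bullet> v)"
        using adj[of b v] Ab[OF b(1)] v(2) by simp
      then show "c \<in> \<mu> ` B" using b by auto
    qed
  qed
  then show ?thesis
    by (intro that[of B \<mu>] fin card B(3) one A)
qed

text \<open>
  Finiteness and nonemptiness make \<^const>\<open>lambda_min\<close> and \<^const>\<open>lambda_max\<close> genuine eigenvalues.
\<close>
lemma eigenvalues_positive_definite:
  fixes A :: "real^'n^'n"
  assumes "positive_definite A"
  shows "finite (eigenvalues A)" "eigenvalues A \<noteq> {}" "\<And>c. c \<in> eigenvalues A \<Longrightarrow> 0 < c"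
proof -
  obtain B :: "(real^'n) set" and \<mu> where "finite B" "card B = CARD('n)" "eigenvalues A = \<mu> ` B"
    by (rule symmetric_spectral_decomposition[OF positive_definite_imp_transpose[OF assms]])
  moreover from this have "B \<noteq> {}" by force
  ultimately show "finite (eigenvalues A)" "eigenvalues A \<noteq> {}" by simp_all
  fix c assume "c \<in> eigenvalues A"
  then obtain v where v: "v \<noteq> 0" "A *v v = c *\<^sub>R v" by (auto simp: eigenvalues_def)
  then have "0 < c * (v \<bullet> v)"
    using assms unfolding positive_definite_def by (metis inner_scaleR_right)
  moreover have "0 < v \<bullet> v" using v(1) by (simp only: inner_gt_zero_iff simp_thms)
  ultimately show "0 < c" by (rule zero_less_mult_pos2)
qed

section \<open>Decomposition into integer squares\<close>

text \<open>
  Replacing each \<open>b b*\<close> in \<open>A - lo I\<close> by its rounded version leaves a diagonal error that the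
  summand \<open>lo I\<close> absorbs. The lower bound on \<open>m\<close> says that the estimate \<open>(d - 1) hi / (4 m\<^sup>2)\<close> of this
  error is at most \<open>lo\<close>, where \<open>d\<close> is the dimension.
\<close>
lemma mem_cone_int_squares:
  fixes A :: "real^'n^'n"
  assumes "positive_definite A" "1 \<le> m"
    and m: "(real CARD('n) - 1) * cond_number A \<le> 4 * (real m)\<^sup>2"
  shows "A \<in> convex_cone hull (int_squares m)"
proof -
  define K where "K = convex_cone hull (int_squares m :: (real^'n^'n) set)"
  obtain B \<mu> where B: "finite B" "card B = CARD('n)" "\<And>b. b \<in> B \<Longrightarrow> norm b = 1"
    and one: "mat 1 = (\<Sum>b\<in>B. outer_square b)"
    and A: "A = (\<Sum>b\<in>B. \<mu> b *\<^sub>R outer_square b)"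
    and ev: "eigenvalues A = \<mu> ` B"
    by (rule symmetric_spectral_decomposition[OF positive_definite_imp_transpose[OF assms(1)]])
      (use that in blast)
  define lo hi where "lo = lambda_min A" and "hi = lambda_max A"
  have "B \<noteq> {}" using B(1,2) by auto
  then have "lo \<in> \<mu> ` B"
    unfolding lo_def lambda_min_def ev using B(1) by (intro Min_in) auto
  then obtain b0 where b0: "b0 \<in> B" "\<mu> b0 = lo" by blast
  have lo_pos: "0 < lo"
    using eigenvalues_positive_definite[OF assms(1)] Min_in unfolding lo_def lambda_min_def by blast
  have bounds: "lo \<le> \<mu> b" "\<mu> b \<le> hi" if "b \<in> B" for b
    using that B(1) unfolding lo_def hi_def lambda_min_def lambda_max_def ev by auto
  have m_pos: "0 < real m" using assms(2) by simp
  define w where "w b = (\<mu> b - lo) / (real m)\<^sup>2" for b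
  have w_nonneg: "0 \<le> w b" if "b \<in> B" for b
    using bounds(1)[OF that] by (simp add: w_def)
  define D where "D b = (\<chi> i. rounding_variance (real m * b $ i))" for b :: "real^'n"
  define P where "P b = outer_square (real m *\<^sub>R b) + diag_matrix (D b)" for b
  have P: "P b \<in> K" if "b \<in> B" for b
  proof -
    have "\<bar>(real m *\<^sub>R b) $ i\<bar> \<le> real m" for i
      using component_le_norm_cart[of b i] B(3)[OF that] m_pos by (simp add: abs_mult)
    then have "P b \<in> convex hull (int_squares m)"
      using rounding_in_convex_hull[of "real m *\<^sub>R b" m] by (simp add: P_def D_def)
    then show ?thesis
      unfolding K_def using convex_hull_subset_convex_cone_hull by blast
  qed
  define c where "c = (\<chi> i. lo) - (\<Sum>b\<in>B. w b *\<^sub>R D b)"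
  have "diag_matrix c \<in> K"
    unfolding K_def
  proof (intro diag_matrix_in_cone assms(2))
    fix i
    \<comment> \<open>Dropping the term of the minimal eigenvector gives the factor \<open>d - 1\<close> instead of \<open>d\<close>.\<close>
    have "(\<Sum>b\<in>B. w b * D b $ i) = (\<Sum>b\<in>B - {b0}. w b * D b $ i)"
      using b0 B(1) by (simp add: sum.remove w_def)
    also have "\<dots> \<le> (\<Sum>b\<in>B - {b0}. hi / (real m)\<^sup>2 * (1 / 4))"
    proof (intro sum_mono mult_mono)
      fix b assume b: "b \<in> B - {b0}"
      then show "w b \<le> hi / (real m)\<^sup>2"
        using bounds(2)[of b] lo_pos m_pos by (auto simp: w_def intro!: divide_right_mono)
      show "D b $ i \<le> 1 / 4"
        using rounding_variance_le by (simp only: D_def vec_lambda_beta)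
      show "0 \<le> D b $ i"
        by (simp add: D_def frac_lt_1 less_imp_le)
      show "0 \<le> hi / (real m)\<^sup>2"
        using bounds[OF b0(1)] lo_pos by simp
    qed
    also have "\<dots> = (real CARD('n) - 1) * hi / (4 * (real m)\<^sup>2)"
      using b0 B(1,2) by (simp add: of_nat_diff Suc_leI)
    also have "\<dots> \<le> lo"
    proof -
      have "(real CARD('n) - 1) * hi \<le> 4 * (real m)\<^sup>2 * lo"
        using m lo_pos unfolding cond_number_def lo_def[symmetric] hi_def[symmetric]
        by (simp only: times_divide_eq_right pos_divide_le_eq)
      then show ?thesis
        using m_pos by (simp add: pos_divide_le_eq mult.commute)
    qed
    finally show "0 \<le> c $ i" by (simp add: c_def)
  qed
  moreover have "(\<Sum>b\<in>B. w b *\<^sub>R P b) \<in> K"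
    unfolding K_def
    by (intro convex_cone_sum_mem[OF convex_cone_convex_cone_hull] convex_cone_hull_mul w_nonneg)
      (use P in \<open>auto simp: K_def\<close>)
  ultimately have "diag_matrix c + (\<Sum>b\<in>B. w b *\<^sub>R P b) \<in> K"
    unfolding K_def by (rule convex_cone_hull_add)
  moreover have "A = diag_matrix c + (\<Sum>b\<in>B. w b *\<^sub>R P b)"
  proof -
    have "(\<Sum>b\<in>B. w b *\<^sub>R P b) = (\<Sum>b\<in>B. (\<mu> b - lo) *\<^sub>R outer_square b + w b *\<^sub>R diag_matrix (D b))"
      using m_pos by (intro sum.cong refl) (simp add: P_def outer_square_scaleR scaleR_add_right w_def)
    also have "\<dots> = A - lo *\<^sub>R mat 1 + diag_matrix (\<Sum>b\<in>B. w b *\<^sub>R D b)"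
      by (subst A)
        (simp add: one sum.distrib scaleR_diff_left sum_subtractf scaleR_sum_right
          linear_sum[OF linear_diag_matrix] linear_cmul[OF linear_diag_matrix])
    finally have "(\<Sum>b\<in>B. w b *\<^sub>R P b) = A - lo *\<^sub>R mat 1 + diag_matrix (\<Sum>b\<in>B. w b *\<^sub>R D b)" .
    moreover have "diag_matrix c = lo *\<^sub>R mat 1 - diag_matrix (\<Sum>b\<in>B. w b *\<^sub>R D b)"
    proof -
      have "diag_matrix (\<chi> i. lo) = lo *\<^sub>R mat 1"
        by (simp add: vec_eq_iff mat_def diag_matrix_def)
      then show ?thesis
        unfolding c_def linear_diff[OF linear_diag_matrix] by (rule arg_cong)
    qed
    moreover have "X = (Y - Z) + (X - Y + Z)" for X Y Z :: "real^'n^'n"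
      by simp
    ultimately show ?thesis by metis
  qed
  ultimately show ?thesis
    unfolding K_def by (rule ssubst[rotated])
qed

theorem theorem1p1:
  fixes A :: "real^'n^'n"
  assumes "positive_definite A"
  shows "\<exists>(m::nat) (r::nat) (\<alpha> :: nat \<Rightarrow> real) (z :: nat \<Rightarrow> int^'n).
           m \<ge> 1 \<and>
           real m \<le> 1 + 1 / 2 * sqrt ((real CARD('n) - 1) * cond_number A) \<and>
           r \<ge> 1 \<and>
           real r \<le> real CARD('n) * (real CARD('n) + 1) / 2 \<and>
           (\<forall>i\<in>{1..r}. \<alpha> i > 0) \<and>
           (\<forall>i\<in>{1..r}. z i \<in> int_vecs m) \<and>
           A = (\<Sum>i=1..r. \<alpha> i *\<^sub>R (real_column (z i) ** transpose (real_column (z i))))"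
proof -
  define s where "s = 1 / 2 * sqrt ((real CARD('n) - 1) * cond_number A)"
  \<comment> \<open>In dimension one \<open>s = 0\<close>, and the maximum keeps \<open>m\<close> positive.\<close>
  define m where "m = max 1 (nat \<lceil>s\<rceil>)"
  have rad: "0 \<le> (real CARD('n) - 1) * cond_number A"
  proof -
    note ev = eigenvalues_positive_definite[OF assms]
    have "0 < lambda_min A" "0 < lambda_max A"
      unfolding lambda_min_def lambda_max_def using ev Min_in Max_in by blast+
    then have "0 \<le> cond_number A" by (simp add: cond_number_def)
    then show ?thesis by (simp add: Suc_leI)
  qed
  then have s_nonneg: "0 \<le> s" by (simp add: s_def)
  have "1 \<le> m" by (simp add: m_def)
  have s_le_m: "s \<le> real m"
    unfolding m_def using real_nat_ceiling_ge[of s] by simp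
  have m_le: "real m \<le> 1 + s"
    unfolding m_def using s_nonneg by (simp add: of_nat_max) linarith
  have "(real CARD('n) - 1) * cond_number A = 4 * s\<^sup>2"
    using rad by (simp add: s_def power_mult_distrib power_divide)
  also have "\<dots> \<le> 4 * (real m)\<^sup>2"
    using s_le_m s_nonneg by (simp add: power_mono)
  finally have "A \<in> convex_cone hull (int_squares m)"
    by (rule mem_cone_int_squares[OF assms \<open>1 \<le> m\<close>])
  then obtain T w where T: "T \<subseteq> int_squares m" "independent T" "\<And>M. M \<in> T \<Longrightarrow> 0 < w M"
      and A: "A = (\<Sum>M\<in>T. w M *\<^sub>R M)"
    by (rule conic_caratheodory) blast
  have fin: "finite T" using T(2) by (rule independent_imp_finite)
  have "T \<subseteq> {M. transpose M = M}"
    using T(1) by (auto simp: int_squares_def real_column_mult_transpose transpose_outer_square)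
  then have "card T \<le> dim {M :: real^'n^'n. transpose M = M}"
    using T(2) by (rule independent_card_le_dim)
  also have "\<dots> \<le> CARD('n) * (CARD('n) + 1) div 2"
    by (rule dim_symmetric_matrices_le)
  finally have "real (card T) \<le> real (CARD('n) * (CARD('n) + 1) div 2)" by (rule of_nat_mono)
  also have "\<dots> \<le> real CARD('n) * (real CARD('n) + 1) / 2"
    using of_nat_div_le_of_nat[where ?'a = real, of "CARD('n) * (CARD('n) + 1)" 2] by (simp add: distrib_left)
  finally have card: "real (card T) \<le> real CARD('n) * (real CARD('n) + 1) / 2" .
  have "T \<noteq> {}"
  proof
    assume "T = {}"
    then have "A = 0" using A by simp
    define e :: "real^'n" where "e = axis undefined 1"
    have "e \<noteq> 0" by (simp add: e_def axis_eq_0_iff)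
    then have "0 < e \<bullet> (A *v e)" using assms unfolding positive_definite_def by blast
    then show False by (simp add: \<open>A = 0\<close>)
  qed
  then have card_pos: "1 \<le> card T" using fin by (simp add: Suc_leI card_gt_0_iff)
  obtain g where g: "bij_betw g {1..card T} T"
    using ex_bij_betw_nat_finite_1[OF fin] by blast
  have "\<forall>M\<in>T. \<exists>z. z \<in> int_vecs m \<and> real_column z ** transpose (real_column z) = M"
    using T(1) unfolding int_squares_def by blast
  then obtain z where z: "\<forall>M\<in>T. z M \<in> int_vecs m \<and>
      real_column (z M) ** transpose (real_column (z M)) = M"
    by (rule bchoice[THEN exE])
  have gT: "g i \<in> T" if "i \<in> {1..card T}" for i
    using g that by (rule bij_betwE[THEN bspec])
  have "A = (\<Sum>i=1..card T. w (g i) *\<^sub>R g i)"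
    unfolding A by (rule sum.reindex_bij_betw[OF g, symmetric])
  also have "\<dots> = (\<Sum>i=1..card T. w (g i) *\<^sub>R (real_column (z (g i)) ** transpose (real_column (z (g i)))))"
    using z gT by (intro sum.cong refl) metis
  finally have "A = (\<Sum>i=1..card T. w (g i) *\<^sub>R (real_column (z (g i)) ** transpose (real_column (z (g i)))))" .
  moreover have "\<forall>i\<in>{1..card T}. 0 < w (g i)" "\<forall>i\<in>{1..card T}. z (g i) \<in> int_vecs m"
    using T(3) z gT by blast+
  ultimately show ?thesis
    using \<open>1 \<le> m\<close> m_le[unfolded s_def] card card_pos
    by (intro exI[of _ m] exI[of _ "card T"] exI[of _ "\<lambda>i. w (g i)"] exI[of _ "\<lambda>i. z (g i)"] conjI)
qed

end
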